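(* For the single-machine makespan problem with uniform linear deterioration, on instances with two distinct release times (every job has $r_i\in\{0,r\}$ for some $r>0$), the best-of-two algorithm, which returns the schedule of smaller makespan among the Non-Idling schedule and the Non-Interfering schedule, is $2$-approximate.
   Context: Problem: a single machine must process a set $\mathcal{J}=\{1,\ldots,n\}$ of jobs non-preemptively, at most one job at a time. Job $i$ has a release time $r_i\ge 0$ and a fixed processing time $\alpha_i\ge 0$, and there is a common deterioration rate $\beta>0$. If job $i$ starts at time $s_i\ge r_i$, its processing time is $p_i(s_i)=\alpha_i+\beta s_i$, so it completes at $C_i=(1+\beta)s_i+\alpha_i$. A schedule is feasible if jobs do not overlap and $s_i\ge r_i$. The makespan is $\max_i C_i$; $T^*$ is the optimal makespan. An algorithm is $\rho$-approximate if its makespan is always at most $\rho T^*$. A job is pending at time $t$ if it is released by $t$ and has not started before $t$. Non-Idling algorithm: at each time $t$ that the machine becomes available and some job is pending, start a pending job with minimum $\alpha_i$ at time $t$ (otherwise wait for the next release). Non-Interfering algorithm: each time $t$ the machine becomes available, let $i$ be a pending job with minimum $\alpha_i$. If there is a job $j$ with $\alpha_j<\alpha_i$ and $t<r_j<(1+\beta)t+\alpha_i$, the machine stays idle during $[t,r_j)$ and the rule is reapplied at time $r_j$; otherwise $i$ is started at time $t$. *)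

theory Defs
  imports Complex_Main
begin

record inst =
  num_jobs :: nat
  release :: "nat \<Rightarrow> real"
  fixed_time :: "nat \<Rightarrow> real"  (* the fixed processing times, alpha_i *)
  rate :: real  (* the common deterioration rate, beta *)

definition jobs :: "inst \<Rightarrow> nat set" where
  "jobs I = {1..num_jobs I}"

definition valid_inst :: "inst \<Rightarrow> bool" where
  "valid_inst I \<longleftrightarrow> num_jobs I \<ge> 1 \<and> rate I > 0 \<and>
     (\<forall>i\<in>jobs I. release I i \<ge> 0 \<and> fixed_time I i \<ge> 0)"

(* A schedule assigns start times; its values outside the job set are irrelevant. *)
type_synonym schedule = "nat \<Rightarrow> real"

definition processing_time :: "inst \<Rightarrow> nat \<Rightarrow> real \<Rightarrow> real" where
  "processing_time I i t = fixed_time I i + rate I * t"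

definition completion :: "inst \<Rightarrow> schedule \<Rightarrow> nat \<Rightarrow> real" where
  "completion I s i = s i + processing_time I i (s i)"

definition feasible :: "inst \<Rightarrow> schedule \<Rightarrow> bool" where
  "feasible I s \<longleftrightarrow>
     (\<forall>i\<in>jobs I. release I i \<le> s i) \<and>
     (\<forall>i\<in>jobs I. \<forall>j\<in>jobs I. i \<noteq> j \<longrightarrow> completion I s i \<le> s j \<or> completion I s j \<le> s i)"

definition makespan :: "inst \<Rightarrow> schedule \<Rightarrow> real" where
  "makespan I s = Max (completion I s ` jobs I)"

definition opt_makespan :: "inst \<Rightarrow> real" where
  "opt_makespan I = (INF s\<in>{s. feasible I s}. makespan I s)"

(* A state (t, S) of an algorithm: the machine is available at time t, and S maps each
   job started so far to its start time.  Being already started is read off from S, not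
   from a comparison of times, because a job of processing time 0 may be started at time 0
   and leave the machine available at time 0. *)
type_synonym state = "real \<times> (nat \<rightharpoonup> real)"

definition pending :: "inst \<Rightarrow> real \<Rightarrow> (nat \<rightharpoonup> real) \<Rightarrow> nat set" where
  "pending I t S = {i \<in> jobs I. release I i \<le> t \<and> i \<notin> dom S}"

definition shortest_pending :: "inst \<Rightarrow> real \<Rightarrow> (nat \<rightharpoonup> real) \<Rightarrow> nat \<Rightarrow> bool" where
  "shortest_pending I t S i \<longleftrightarrow> is_arg_min (fixed_time I) (\<lambda>j. j \<in> pending I t S) i"

definition future_releases :: "inst \<Rightarrow> real \<Rightarrow> real set" where
  "future_releases I t = release I ` {j \<in> jobs I. t < release I j}"

(* Both step relations are nondeterministic: ties in fixed_time may be broken in any way. *)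
inductive non_idling_step :: "inst \<Rightarrow> state \<Rightarrow> state \<Rightarrow> bool" for I where
  start: "shortest_pending I t S i \<Longrightarrow>
    non_idling_step I (t, S) (t + processing_time I i t, S(i \<mapsto> t))"
| wait: "pending I t S = {} \<Longrightarrow> future_releases I t \<noteq> {} \<Longrightarrow>
    non_idling_step I (t, S) (Min (future_releases I t), S)"

definition interferes :: "inst \<Rightarrow> real \<Rightarrow> nat \<Rightarrow> nat \<Rightarrow> bool" where
  "interferes I t i j \<longleftrightarrow> j \<in> jobs I \<and> fixed_time I j < fixed_time I i \<and>
     t < release I j \<and> release I j < t + processing_time I i t"

inductive non_interfering_step :: "inst \<Rightarrow> state \<Rightarrow> state \<Rightarrow> bool" for I where
  start: "shortest_pending I t S i \<Longrightarrow> \<not> (\<exists>j. interferes I t i j) \<Longrightarrow>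
    non_interfering_step I (t, S) (t + processing_time I i t, S(i \<mapsto> t))"
| idle: "shortest_pending I t S i \<Longrightarrow> interferes I t i j \<Longrightarrow>
    non_interfering_step I (t, S) (release I j, S)"
| wait: "pending I t S = {} \<Longrightarrow> future_releases I t \<noteq> {} \<Longrightarrow>
    non_interfering_step I (t, S) (Min (future_releases I t), S)"

(* s is the outcome of a run from time 0 that has started every job. *)
definition outcome :: "(inst \<Rightarrow> state \<Rightarrow> state \<Rightarrow> bool) \<Rightarrow> inst \<Rightarrow> schedule \<Rightarrow> bool" where
  "outcome step I s \<longleftrightarrow>
     (\<exists>t S. (step I)\<^sup>*\<^sup>* (0, Map.empty) (t, S) \<and> (\<forall>i\<in>jobs I. S i = Some (s i)))"

(* An algorithm is the relation between instances and the schedules it may return. *)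
type_synonym algorithm = "inst \<Rightarrow> schedule \<Rightarrow> bool"

definition non_idling :: algorithm where
  "non_idling = outcome non_idling_step"

definition non_interfering :: algorithm where
  "non_interfering = outcome non_interfering_step"

definition best_of_two :: "algorithm \<Rightarrow> algorithm \<Rightarrow> algorithm" where
  "best_of_two A B I s \<longleftrightarrow>
     (\<exists>s1 s2. A I s1 \<and> B I s2 \<and> s \<in> {s1, s2} \<and>
        makespan I s = min (makespan I s1) (makespan I s2))"

(* Because algorithms are relations, the conjunct on existence of an output is needed to
   prevent an algorithm without outputs from being vacuously approximate. *)
definition approximate_on :: "inst set \<Rightarrow> real \<Rightarrow> algorithm \<Rightarrow> bool" where
  "approximate_on K \<rho> A \<longleftrightarrow>
     (\<forall>I\<in>K. (\<exists>s. A I s) \<and>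
        (\<forall>s. A I s \<longrightarrow> feasible I s \<and> makespan I s \<le> \<rho> * opt_makespan I))"

definition two_release_insts :: "inst set" where
  "two_release_insts =
     {I. valid_inst I \<and> (\<exists>r>0. \<forall>i\<in>jobs I. release I i \<in> {0, r})}"

end

theory Submission
  imports Defs
begin

text \<open>
  From any starting time, processing the jobs smallest first minimises the finishing time over all
  sequences of at least as many of the jobs.  Let an arbitrary feasible schedule start the set
  $Q$ of jobs before $r$, and let $e \ge r$ be a time by which these are done and before which no
  other job starts.  Suppose that an algorithm starts, before $r$, the $k \ge |Q|$ smallest early
  jobs, and then the rest smallest first from a time at most $e$.  Its late jobs can be matched
  with distinct late jobs of the given schedule such that only jobs of $Q$ are replacements for
  other jobs; replacing costs at most $(1+\beta)^m \sum_{i \in Q} \alpha_i$, where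
  $m$ is the number of late jobs in the given schedule.  As $Q$ is processed by time $e$, this sum
  is at most $e$, so the cost is at most $(1+\beta)^m e$, which is itself a lower bound on the
  given makespan: the algorithm loses at most a factor 2.

  If the Non-Idling run of early jobs ends by $e$, the argument applies to Non-Idling.  Otherwise
  its last early job crosses $r$, and $Q$ has fewer jobs than that run.  Non-Interfering
  completes as many early jobs as possible by time $r$, at least $|Q|$, and finishes no later than
  if it started the rest smallest first at $r$, so that the argument applies to it.
\<close>

subsection \<open>Smallest-first sequences\<close>

text \<open>A relation rather than a sorting function, because ties may be broken in any way. The
  list need not exhaust \<open>A\<close>, so that it can describe an unfinished run.\<close>

primrec greedy :: "inst \<Rightarrow> nat set \<Rightarrow> nat list \<Rightarrow> bool" where
  "greedy I A [] \<longleftrightarrow> True"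
| "greedy I A (a # as) \<longleftrightarrow> is_arg_min (fixed_time I) (\<lambda>j. j \<in> A) a \<and> greedy I (A - {a}) as"

primrec finish :: "inst \<Rightarrow> real \<Rightarrow> nat list \<Rightarrow> real" where
  "finish I t [] = t"
| "finish I t (x # xs) = finish I (t + processing_time I x t) xs"

lemma finish_append: "finish I t (xs @ ys) = finish I (finish I t xs) ys"
  by (induction xs arbitrary: t) auto

text \<open>Each job multiplies a delay of its start by \<open>1 + rate I\<close>.\<close>

lemma finish_shift: "finish I (t + d) xs = finish I t xs + (1 + rate I) ^ length xs * d"
proof (induction xs arbitrary: t d)
  case (Cons x xs)
  have "t + d + processing_time I x (t + d) = (t + processing_time I x t) + (1 + rate I) * d"
    by (simp add: processing_time_def algebra_simps)
  then have "finish I (t + d) (x # xs) = finish I (t + processing_time I x t + (1 + rate I) * d) xs"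
    by (simp only: finish.simps)
  also have "\<dots> = finish I t (x # xs) + (1 + rate I) ^ length (x # xs) * d"
    by (simp only: Cons finish.simps length_Cons power_Suc2 mult.assoc)
  finally show ?case .
qed simp

lemma greedy_append:
  "greedy I A (as @ bs) \<longleftrightarrow> greedy I A as \<and> greedy I (A - set as) bs"
  by (induction as arbitrary: A) (auto simp: Diff_insert2[symmetric])

lemma greedy_set: "greedy I A as \<Longrightarrow> distinct as \<and> set as \<subseteq> A"
  by (induction as arbitrary: A) (auto simp: is_arg_min_def)

locale valid_instance =
  fixes I :: inst
  assumes valid: "valid_inst I"
begin

lemma rate_pos: "rate I > 0"
  using valid by (simp add: valid_inst_def)

lemma fixed_time_nonneg: "i \<in> jobs I \<Longrightarrow> fixed_time I i \<ge> 0"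
  using valid by (simp add: valid_inst_def)

lemma release_nonneg: "i \<in> jobs I \<Longrightarrow> release I i \<ge> 0"
  using valid by (simp add: valid_inst_def)

lemma finite_jobs [simp]: "finite (jobs I)"
  by (simp add: jobs_def)

lemma jobs_nonempty: "jobs I \<noteq> {}"
  using valid by (auto simp: valid_inst_def jobs_def)

lemma processing_time_nonneg: "i \<in> jobs I \<Longrightarrow> 0 \<le> t \<Longrightarrow> 0 \<le> processing_time I i t"
  using rate_pos fixed_time_nonneg by (simp add: processing_time_def)

lemma finish_mono: "t \<le> u \<Longrightarrow> finish I t xs \<le> finish I u xs"
  using finish_shift[of I t "u - t" xs] rate_pos by simp

text \<open>At a nonnegative time a processing time is at least its fixed part. This later bounds
  the total fixed time of the jobs that a schedule starts before \<open>r\<close>.\<close>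

lemma finish_ge_sum:
  "set xs \<subseteq> jobs I \<Longrightarrow> distinct xs \<Longrightarrow> 0 \<le> t \<Longrightarrow>
    t + (\<Sum>x\<in>set xs. fixed_time I x) \<le> finish I t xs"
proof (induction xs arbitrary: t)
  case (Cons x xs)
  have "0 \<le> t + processing_time I x t"
    using Cons.prems processing_time_nonneg[of x t] by simp
  then have "t + processing_time I x t + (\<Sum>x\<in>set xs. fixed_time I x) \<le> finish I t (x # xs)"
    using Cons by simp
  moreover have "fixed_time I x \<le> processing_time I x t"
    using Cons.prems rate_pos by (simp add: processing_time_def)
  ultimately show ?case
    using Cons.prems by simp
qed simp

lemma finish_ge: "set xs \<subseteq> jobs I \<Longrightarrow> 0 \<le> t \<Longrightarrow> t \<le> finish I t xs"
proof (induction xs arbitrary: t)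
  case (Cons x xs)
  then show ?case
    using processing_time_nonneg[of x t] Cons.IH[of "t + processing_time I x t"] by fastforce
qed simp

text \<open>Started at 0, the sequence ends at a nonnegative time; shifting the start by
  \<open>t\<close> adds exactly the power term.\<close>

lemma finish_ge_power:
  assumes "set xs \<subseteq> jobs I"
  shows "(1 + rate I) ^ length xs * t \<le> finish I t xs"
  using finish_shift[of I 0 t xs] finish_ge[OF assms, of 0] by simp

lemma finish_filter:
  "set xs \<subseteq> jobs I \<Longrightarrow> 0 \<le> t \<Longrightarrow> finish I t (filter P xs) \<le> finish I t xs"
proof (induction xs arbitrary: t)
  case (Cons x xs)
  have p: "0 \<le> processing_time I x t"
    using Cons.prems processing_time_nonneg by simp
  show ?case
  proof (cases "P x")
    case True
    then show ?thesis using Cons p by simp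
  next
    case False
    have "finish I t (filter P xs) \<le> finish I t xs"
      using Cons by simp
    also have "\<dots> \<le> finish I t (x # xs)"
      using p finish_mono[of t "t + processing_time I x t" xs] by simp
    finally show ?thesis using False by simp
  qed
qed simp

text \<open>Smallest-job-first exchange: \<^term>\<open>a\<close> swaps places with the head \<^term>\<open>u\<close> if it occurs
  in the list and replaces it otherwise.\<close>

lemma finish_exchange:
  assumes "fixed_time I a \<le> fixed_time I u" "distinct (u # us)" "set (u # us) \<subseteq> A" "a \<in> A"
  obtains vs where "distinct vs" "set vs \<subseteq> A - {a}" "length vs = length us"
    "finish I t (a # vs) \<le> finish I t (u # us)"
proof (cases "a \<in> set us")
  case False
  have "finish I t (a # us) \<le> finish I t (u # us)"
    using assms(1) by (simp add: processing_time_def finish_mono)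
  moreover have "set us \<subseteq> A - {a}"
    using assms False by auto
  ultimately show ?thesis
    using that[of us] assms by simp
next
  case True
  then obtain p q where us: "us = p @ a # q"
    by (meson split_list)
  define d where "d = fixed_time I u - fixed_time I a"
  define X where "X = finish I (t + processing_time I a t) p"
  have d: "0 \<le> d"
    using assms(1) by (simp add: d_def)
  have "t + processing_time I u t = t + processing_time I a t + d"
    by (simp add: d_def processing_time_def)
  then have u: "finish I (t + processing_time I u t) p = X + (1 + rate I) ^ length p * d"
    by (simp only: finish_shift X_def)
  \<comment> \<open>With \<open>u\<close> first, \<open>p\<close> ends later than with
    \<open>a\<close> first. This delay, amplified once more by job \<open>a\<close>, outweighs the
    extra fixed time \<open>d\<close> of \<open>u\<close> in the later position.\<close>
  have "1 * d \<le> (1 + rate I) ^ Suc (length p) * d"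
    using rate_pos d by (intro mult_right_mono one_le_power) auto
  then have "X + processing_time I u X
      \<le> (X + (1 + rate I) ^ length p * d) + processing_time I a (X + (1 + rate I) ^ length p * d)"
    by (simp add: d_def processing_time_def algebra_simps)
  then have "finish I t (a # p @ u # q) \<le> finish I t (u # us)"
    by (simp add: us finish_append u X_def[symmetric] finish_mono)
  moreover have "set (p @ u # q) \<subseteq> A - {a}" "distinct (p @ u # q)"
    using assms us by auto
  ultimately show ?thesis
    using that[of "p @ u # q"] us by simp
qed

text \<open>By \<open>finish_exchange\<close> the competitor may be assumed to begin with the greedy
  head; the tails are then compared by induction.\<close>

lemma greedy_finish_le:
  assumes "greedy I A as" "distinct xs" "set xs \<subseteq> A" "length as \<le> length xs"
    "A \<subseteq> jobs I" "0 \<le> t"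
  shows "finish I t as \<le> finish I t xs"
  using assms
proof (induction as arbitrary: A xs t)
  case Nil
  then show ?case
    using finish_ge[of xs t] by auto
next
  case (Cons a as)
  then obtain u us where xs: "xs = u # us"
    by (cases xs) auto
  have a: "a \<in> A" "fixed_time I a \<le> fixed_time I u"
    using Cons.prems xs by (auto simp: is_arg_min_linorder)
  obtain vs where vs: "distinct vs" "set vs \<subseteq> A - {a}" "length vs = length us"
    "finish I t (a # vs) \<le> finish I t (u # us)"
    using finish_exchange[of a u us A t] a Cons.prems xs by metis
  have "0 \<le> t + processing_time I a t"
    using processing_time_nonneg[of a t] a Cons.prems by auto
  then have "finish I t (a # as) \<le> finish I t (a # vs)"
    using Cons.IH[of "A - {a}" vs "t + processing_time I a t"] Cons.prems vs xs by auto
  then show ?case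
    using vs xs by simp
qed

text \<open>Induction on the number of jobs of \<open>D\<close> missing from \<open>ys\<close>. Each
  takes the place of a job outside \<open>D\<close>, at the cost of at most its fixed time amplified
  by the jobs behind it. Once none is missing, \<open>ys\<close> is restricted to \<open>D\<close>
  and compared with the greedy list.\<close>

lemma greedy_finish_le_replaced:
  assumes "greedy I D bs" "distinct ys" "set ys \<subseteq> jobs I" "card D \<le> length ys"
    "D \<subseteq> jobs I" "0 \<le> t"
  shows "finish I t bs
    \<le> finish I t ys + (1 + rate I) ^ length ys * (\<Sum>x\<in>D - set ys. fixed_time I x)"
  using assms
proof (induction "card (D - set ys)" arbitrary: ys)
  case 0
  have fin: "finite D"
    using \<open>D \<subseteq> jobs I\<close> finite_jobs by (rule finite_subset)
  then have sub: "D \<subseteq> set ys"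
    using 0 by simp
  let ?zs = "filter (\<lambda>x. x \<in> D) ys"
  have zs: "set ?zs = D" "distinct ?zs"
    using sub 0 by auto
  have "length bs \<le> card D"
    using greedy_set[OF \<open>greedy I D bs\<close>] fin by (metis card_mono distinct_card)
  also have "card D = length ?zs"
    using zs by (metis distinct_card)
  finally have "finish I t bs \<le> finish I t ?zs"
    using greedy_finish_le[of D bs ?zs t] 0 zs by simp
  also have "\<dots> \<le> finish I t ys"
    using finish_filter 0 by simp
  finally show ?case
    using sub by (simp add: Diff_eq_empty_iff[THEN iffD2])
next
  case (Suc n)
  have fin: "finite D"
    using \<open>D \<subseteq> jobs I\<close> finite_jobs by (rule finite_subset)
  obtain x where x: "x \<in> D" "x \<notin> set ys"
    using Suc(2) by (metis Diff_iff card.empty ex_in_conv nat.distinct(1))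
  \<comment> \<open>As \<open>x\<close> is missing, at least \<open>card D\<close> distinct jobs
    cannot all lie in \<open>D\<close>.\<close>
  have "\<not> set ys \<subseteq> D"
  proof
    assume "set ys \<subseteq> D"
    moreover have "card D \<le> card (set ys)"
      using Suc by (simp add: distinct_card)
    ultimately show False
      using fin x card_seteq by blast
  qed
  then obtain p us vs where p: "p \<notin> D" "ys = us @ p # vs"
    by (meson split_list subsetI)
  define zs where "zs = us @ x # vs"
  have D: "D - set ys = insert x (D - set zs)" "x \<notin> D - set zs"
    using x p by (auto simp: zs_def)
  have xj: "x \<in> jobs I" and pj: "p \<in> jobs I"
    using x p Suc by auto
  have len: "length zs = length ys"
    by (simp add: zs_def p)
  have "n = card (D - set zs)"
    using Suc(2) D fin by simp
  then have IH: "finish I t bs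
      \<le> finish I t zs + (1 + rate I) ^ length ys * (\<Sum>x\<in>D - set zs. fixed_time I x)"
    using Suc(1)[of zs] Suc.prems x p xj len by (auto simp: zs_def)
  define X where "X = finish I t us"
  \<comment> \<open>Job \<open>x\<close> in the place of \<open>p\<close> is bounded by keeping
    \<open>p\<close> and adding the fixed time of \<open>x\<close> as a delay.\<close>
  have "finish I t zs \<le> finish I (X + processing_time I p X + fixed_time I x) vs"
    using fixed_time_nonneg[OF pj]
    by (simp add: zs_def finish_append X_def[symmetric] processing_time_def finish_mono)
  also have "\<dots> = finish I t ys + (1 + rate I) ^ length vs * fixed_time I x"
    by (simp add: p finish_append X_def finish_shift)
  also have "\<dots> \<le> finish I t ys + (1 + rate I) ^ length ys * fixed_time I x"
    using rate_pos fixed_time_nonneg[OF xj] p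
    by (intro add_left_mono mult_right_mono power_increasing) auto
  finally show ?case
    using IH D fin by (simp add: algebra_simps)
qed

section \<open>Feasible schedules as job sequences\<close>

lemma start_nonneg: "feasible I s \<Longrightarrow> i \<in> jobs I \<Longrightarrow> 0 \<le> s i"
  using release_nonneg unfolding feasible_def by fastforce

lemma start_le_completion: "feasible I s \<Longrightarrow> i \<in> jobs I \<Longrightarrow> s i \<le> completion I s i"
  using processing_time_nonneg start_nonneg by (simp add: completion_def)

lemma no_overlap:
  "feasible I s \<Longrightarrow> i \<in> jobs I \<Longrightarrow> j \<in> jobs I \<Longrightarrow> i \<noteq> j \<Longrightarrow>
    completion I s i \<le> s j \<or> completion I s j \<le> s i"
  by (simp add: feasible_def)

text \<open>Removing idle time and ignoring release times only moves jobs earlier. The induction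
  splits off the first job of \<open>R\<close>.\<close>

lemma feasible_list:
  assumes "feasible I s" "R \<subseteq> jobs I" "\<And>i. i \<in> R \<Longrightarrow> t \<le> s i"
    "\<And>i. i \<in> R \<Longrightarrow> completion I s i \<le> M" "t \<le> M"
  shows "\<exists>xs. distinct xs \<and> set xs = R \<and> finish I t xs \<le> M"
  using assms(2-)
proof (induction "card R" arbitrary: R t)
  case 0
  then have "R = {}"
    using finite_subset[OF _ finite_jobs] by auto
  then show ?case
    using 0 by auto
next
  case (Suc n)
  have fin: "finite R"
    using Suc finite_subset[OF _ finite_jobs] by auto
  note c = start_le_completion[OF assms(1)]
  have "R \<noteq> {}"
    using Suc(2) by auto
  \<comment> \<open>Jobs of processing time 0 can share their start time with another job; minimising the sum
    instead of the start time still selects a job that precedes all others.\<close>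
  then obtain i where i: "i \<in> R"
    "\<And>j. j \<in> R \<Longrightarrow> s i + completion I s i \<le> s j + completion I s j"
    using ex_is_arg_min_if_finite[OF fin, of "\<lambda>i. s i + completion I s i"]
    by (auto simp: is_arg_min_linorder)
  have first: "completion I s i \<le> s j" if "j \<in> R - {i}" for j
  proof -
    have "completion I s i \<le> s j \<or> completion I s j \<le> s i"
      using no_overlap[OF assms(1), of i j] that i Suc.prems(1) by blast
    then show ?thesis
      using i(2)[of j] c[of j] c[of i] that i(1) Suc.prems(1) by fastforce
  qed
  have "n = card (R - {i})"
    using Suc(2) i fin by simp
  then obtain xs where xs: "distinct xs" "set xs = R - {i}" "finish I (completion I s i) xs \<le> M"
    using Suc(1)[of "R - {i}" "completion I s i"] Suc.prems first i by blast
  have "t + processing_time I i t \<le> completion I s i"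
    using Suc.prems(2)[OF i(1)] rate_pos
    by (simp add: completion_def processing_time_def add_mono)
  then have "finish I t (i # xs) \<le> M"
    using xs finish_mono[of "t + processing_time I i t" "completion I s i" xs] by simp
  then show ?case
    using xs i by (intro exI[of _ "i # xs"]) auto
qed

lemma completion_le_makespan: "i \<in> jobs I \<Longrightarrow> completion I s i \<le> makespan I s"
  by (simp add: makespan_def)

lemma makespan_le_iff: "makespan I s \<le> M \<longleftrightarrow> (\<forall>i\<in>jobs I. completion I s i \<le> M)"
  using jobs_nonempty by (auto simp: makespan_def)

subsection \<open>Runs of list-scheduling algorithms\<close>

text \<open>What both step relations have in common; it suffices for termination and
  feasibility.\<close>

definition advances :: "state \<Rightarrow> state \<Rightarrow> bool" where
  "advances st st' \<longleftrightarrow> (\<exists>t S. st = (t, S) \<and>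
     ((\<exists>i\<in>pending I t S. st' = (t + processing_time I i t, S(i \<mapsto> t))) \<or>
      (\<exists>j\<in>jobs I. t < release I j \<and> st' = (release I j, S))))"

text \<open>The invariant that makes every outcome feasible, with the available time of the machine
  as a bound on its makespan.\<close>

definition consistent :: "state \<Rightarrow> bool" where
  "consistent st \<longleftrightarrow> (\<exists>t S. st = (t, S) \<and> 0 \<le> t \<and>
     (\<forall>i x. S i = Some x \<longrightarrow> i \<in> jobs I \<and> release I i \<le> x \<and> x + processing_time I i x \<le> t) \<and>
     (\<forall>i j x y. i \<noteq> j \<longrightarrow> S i = Some x \<longrightarrow> S j = Some y \<longrightarrow>
        x + processing_time I i x \<le> y \<or> y + processing_time I j y \<le> x))"

lemma advances_consistent:
  assumes "advances st st'" "consistent st"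
  shows "consistent st'"
proof -
  obtain t S where st: "st = (t, S)"
    by (cases st)
  have t: "0 \<le> t" and
    S: "\<And>i x. S i = Some x \<Longrightarrow> i \<in> jobs I \<and> release I i \<le> x \<and> x + processing_time I i x \<le> t" and
    dis: "\<And>i j x y. i \<noteq> j \<Longrightarrow> S i = Some x \<Longrightarrow> S j = Some y \<Longrightarrow>
        x + processing_time I i x \<le> y \<or> y + processing_time I j y \<le> x"
    using assms(2) unfolding consistent_def st by blast+
  consider (start) i where "i \<in> pending I t S" "st' = (t + processing_time I i t, S(i \<mapsto> t))"
    | (wait) j where "j \<in> jobs I" "t < release I j" "st' = (release I j, S)"
    using assms(1) unfolding advances_def st by blast
  then show ?thesis
  proof cases
    case start
    have i: "i \<in> jobs I" "release I i \<le> t" "0 \<le> processing_time I i t"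
      using start t processing_time_nonneg by (auto simp: pending_def)
    show ?thesis
      unfolding consistent_def start(2)
      using t i S dis by (fastforce split: if_splits)
  next
    case wait
    then show ?thesis
      unfolding consistent_def using t S dis by fastforce
  qed
qed

lemma outcome_of_advancing:
  assumes adv: "\<And>st st'. step I st st' \<Longrightarrow> advances st st'"
    and progress: "\<And>t S. \<not> jobs I \<subseteq> dom S \<Longrightarrow> \<exists>st'. step I (t, S) st'"
  shows "\<exists>s. outcome step I s"
proof -
  \<comment> \<open>Termination measure: unstarted jobs plus jobs with a release still ahead. A
    start lowers the first summand, a move to a release the second, and neither raises the
    other.\<close>
  define m :: "state \<Rightarrow> nat" where
    "m st = card (jobs I - dom (snd st)) + card {j \<in> jobs I. fst st < release I j}" for st
  have dec: "m st' < m st" if "step I st st'" "consistent st" for st st'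
  proof -
    obtain t S where st: "st = (t, S)"
      by (cases st)
    have "advances (t, S) st'" and t: "0 \<le> t"
      using that adv st by (auto simp: consistent_def)
    then consider
      (start) i where "i \<in> pending I t S" "st' = (t + processing_time I i t, S(i \<mapsto> t))"
      | (wait) j where "j \<in> jobs I" "t < release I j" "st' = (release I j, S)"
      unfolding advances_def by blast
    then show ?thesis
    proof cases
      case start
      have "0 \<le> processing_time I i t"
        using start t processing_time_nonneg by (auto simp: pending_def)
      then have "card {j \<in> jobs I. t + processing_time I i t < release I j}
          \<le> card {j \<in> jobs I. t < release I j}"
        by (intro card_mono) auto
      moreover have "card (jobs I - dom (S(i \<mapsto> t))) < card (jobs I - dom S)"
        using start by (intro psubset_card_mono) (auto simp: pending_def)
      ultimately show ?thesis
        using start st by (simp add: m_def)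
    next
      case wait
      have "card {k \<in> jobs I. release I j < release I k} < card {k \<in> jobs I. t < release I k}"
        using wait by (intro psubset_card_mono) auto
      then show ?thesis
        using wait st by (simp add: m_def)
    qed
  qed
  have "\<exists>t S. (step I)\<^sup>*\<^sup>* st (t, S) \<and> jobs I \<subseteq> dom S" if "consistent st" for st
    using that
  proof (induction "m st" arbitrary: st rule: less_induct)
    case less
    obtain t S where st: "st = (t, S)"
      by (cases st)
    show ?case
    proof (cases "jobs I \<subseteq> dom S")
      case True
      then show ?thesis
        using st by blast
    next
      case False
      then obtain st' where st': "step I st st'"
        using progress st by blast
      then show ?thesis
        using less dec adv advances_consistent by (meson converse_rtranclp_into_rtranclp)
    qed
  qed
  moreover have "consistent (0, Map.empty)"
    by (simp add: consistent_def)
  ultimately obtain t S where "(step I)\<^sup>*\<^sup>* (0, Map.empty) (t, S)" "jobs I \<subseteq> dom S"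
    by blast
  then have "outcome step I (\<lambda>i. the (S i))"
    unfolding outcome_def by (metis domIff option.collapse subsetD)
  then show ?thesis
    by blast
qed

lemma reachable_consistent:
  assumes adv: "\<And>st st'. step I st st' \<Longrightarrow> advances st st'"
    and "(step I)\<^sup>*\<^sup>* (0, Map.empty) st"
  shows "consistent st"
  using assms(2)
proof (induction rule: rtranclp_induct)
  case base
  then show ?case
    by (simp add: consistent_def)
next
  case (step y z)
  then show ?case
    using adv advances_consistent by blast
qed

lemma consistent_feasible:
  assumes "consistent (t, S)" "\<forall>i\<in>jobs I. S i = Some (s i)"
  shows "feasible I s" "makespan I s \<le> t"
proof -
  show "feasible I s"
    using assms unfolding consistent_def feasible_def completion_def by blast
  show "makespan I s \<le> t"
    using assms unfolding consistent_def makespan_le_iff completion_def by blast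
qed

lemma Min_future_releases:
  assumes "future_releases I t \<noteq> {}"
  shows "\<exists>j\<in>jobs I. t < release I j \<and> Min (future_releases I t) = release I j"
proof -
  have "Min (future_releases I t) \<in> future_releases I t"
    using assms by (intro Min_in) (auto simp: future_releases_def)
  then show ?thesis
    by (auto simp: future_releases_def)
qed

lemma non_idling_advances:
  assumes "non_idling_step I st st'"
  shows "advances st st'"
  using assms
proof cases
  case (wait t S)
  then show ?thesis
    using Min_future_releases[of t] by (auto simp: advances_def)
qed (auto simp: advances_def shortest_pending_def is_arg_min_def)

lemma non_interfering_advances:
  assumes "non_interfering_step I st st'"
  shows "advances st st'"
  using assms
proof cases
  case (wait t S)
  then show ?thesis
    using Min_future_releases[of t] by (auto simp: advances_def)
qed (auto simp: advances_def shortest_pending_def is_arg_min_def interferes_def)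

lemma pending_or_future:
  assumes "\<not> jobs I \<subseteq> dom S"
  shows "(\<exists>i. shortest_pending I t S i) \<or> (pending I t S = {} \<and> future_releases I t \<noteq> {})"
proof (cases "pending I t S = {}")
  case True
  then show ?thesis
    using assms by (force simp: pending_def future_releases_def)
next
  case False
  have "finite (pending I t S)"
    by (simp add: pending_def)
  then show ?thesis
    using False ex_is_arg_min_if_finite unfolding shortest_pending_def by blast
qed

lemma non_idling_progress: "\<not> jobs I \<subseteq> dom S \<Longrightarrow> \<exists>st'. non_idling_step I (t, S) st'"
  using pending_or_future[of S t] by (metis non_idling_step.intros)

lemma non_interfering_progress: "\<not> jobs I \<subseteq> dom S \<Longrightarrow> \<exists>st'. non_interfering_step I (t, S) st'"
  using pending_or_future[of S t] by (metis non_interfering_step.intros)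

text \<open>\<open>Q\<close> and \<open>P\<close> are the jobs counted as early in the given
  schedule and in the algorithm. Late jobs of the algorithm that are missing from \<open>ys\<close>
  lie in \<open>Q\<close>, whose fixed times sum to at most \<open>e\<close>. So replacements cost
  at most \<open>(1 + rate I) ^ length ys * e\<close>, itself a lower bound on
  \<open>finish I e ys\<close>.\<close>

lemma finish_le_twice:
  assumes "distinct xs" "set xs = Q" "finish I 0 xs \<le> e"
    and "distinct ys" "set ys = jobs I - Q" "Q \<subseteq> jobs I"
    and "greedy I (jobs I - P) bs" "P \<subseteq> jobs I" "card Q \<le> card P" "u \<le> e"
  shows "finish I u bs \<le> 2 * finish I e ys"
proof -
  have sum: "(\<Sum>x\<in>Q. fixed_time I x) \<le> e"
    using finish_ge_sum[of xs 0] assms by simp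
  moreover have "0 \<le> (\<Sum>x\<in>Q. fixed_time I x)"
    using fixed_time_nonneg assms by (intro sum_nonneg) auto
  ultimately have e: "0 \<le> e"
    by simp
  have "(\<Sum>x\<in>jobs I - P - set ys. fixed_time I x) \<le> (\<Sum>x\<in>Q. fixed_time I x)"
    using assms fixed_time_nonneg by (intro sum_mono2) (auto intro: finite_subset)
  then have D: "(\<Sum>x\<in>jobs I - P - set ys. fixed_time I x) \<le> e"
    using sum by simp
  have "length ys = card (jobs I) - card Q"
    using assms distinct_card[of ys] by (simp add: card_Diff_subset finite_subset)
  then have "card (jobs I - P) \<le> length ys"
    using assms by (simp add: card_Diff_subset finite_subset[OF _ finite_jobs])
  then have "finish I e bs \<le> finish I e ys
      + (1 + rate I) ^ length ys * (\<Sum>x\<in>jobs I - P - set ys. fixed_time I x)"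
    using assms e by (intro greedy_finish_le_replaced) auto
  also have "\<dots> \<le> finish I e ys + (1 + rate I) ^ length ys * e"
    using D rate_pos by simp
  also have "\<dots> \<le> 2 * finish I e ys"
    using finish_ge_power[of ys e] assms by auto
  finally show ?thesis
    using finish_mono[OF assms(10), of bs] by simp
qed

end

subsection \<open>Two release times\<close>

text \<open>No job has to be released at \<open>r\<close>, so \<open>r\<close> can be chosen freely
  when all jobs are released at 0.\<close>

locale two_release_instance = valid_instance +
  fixes r :: real
  assumes r_pos: "0 < r" and two_releases: "\<And>i. i \<in> jobs I \<Longrightarrow> release I i \<in> {0, r}"
begin

definition early :: "nat set" where
  "early = {i \<in> jobs I. release I i = 0}"

lemma early_subset: "early \<subseteq> jobs I"
  by (auto simp: early_def)

lemma pending_early: "0 \<le> t \<Longrightarrow> t < r \<Longrightarrow> pending I t S = early - dom S"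
  using two_releases by (fastforce simp: pending_def early_def)

lemma pending_late: "r \<le> t \<Longrightarrow> pending I t S = jobs I - dom S"
  using two_releases r_pos by (fastforce simp: pending_def)

lemma future_release_eq: "0 \<le> t \<Longrightarrow> j \<in> jobs I \<Longrightarrow> t < release I j \<Longrightarrow> release I j = r"
  using two_releases by fastforce

lemma no_future_release: "r \<le> t \<Longrightarrow> future_releases I t = {}"
  using two_releases r_pos by (fastforce simp: future_releases_def)

text \<open>Either algorithm, once idle before \<open>r\<close>, stays idle until \<open>r\<close>;
  so a state with time below \<open>r\<close> has no idle time behind it.\<close>

definition early_run :: "state \<Rightarrow> nat list \<Rightarrow> bool" where
  "early_run st as \<longleftrightarrow> greedy I early as \<and> dom (snd st) = set as \<and> fst st = finish I 0 as"

text \<open>\<open>as\<close> need not contain every job started before \<open>r\<close>: a job of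
  Non-Interfering that crosses \<open>r\<close> counts as the first of \<open>bs\<close>.\<close>

definition late_run :: "state \<Rightarrow> nat list \<Rightarrow> nat list \<Rightarrow> bool" where
  "late_run st as bs \<longleftrightarrow> greedy I early as \<and> greedy I (jobs I - set as) bs \<and>
     dom (snd st) = set as \<union> set bs"

text \<open>Here a job that crosses \<open>r\<close> is the last of \<open>as\<close>, whence the
  \<open>max\<close> and the condition on \<open>butlast as\<close>. The list \<open>as\<close>
  stops only for lack of early jobs or on reaching \<open>r\<close>.\<close>

definition non_idling_inv :: "state \<Rightarrow> bool" where
  "non_idling_inv st \<longleftrightarrow> 0 \<le> fst st \<and>
     (if fst st < r then \<exists>as. early_run st as
      else \<exists>as bs. late_run st as bs \<and> fst st = finish I (max r (finish I 0 as)) bs \<and>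
        (set as = early \<or> r \<le> finish I 0 as) \<and> (as = [] \<or> finish I 0 (butlast as) < r))"

text \<open>The time is bounded by an inequality because the first job of \<open>bs\<close> may have
  started before \<open>r\<close>. The last condition serves to compare \<open>as\<close> with the
  early jobs of other schedules.\<close>

definition non_interfering_inv :: "state \<Rightarrow> bool" where
  "non_interfering_inv st \<longleftrightarrow> 0 \<le> fst st \<and>
     (if fst st < r then \<exists>as. early_run st as
      else \<exists>as bs. late_run st as bs \<and> fst st \<le> finish I r bs \<and>
        (\<forall>xs. distinct xs \<longrightarrow> set xs \<subseteq> early \<longrightarrow> finish I 0 xs < r \<longrightarrow> length xs \<le> length as))"

lemma non_idling_inv_earlyI:
  "early_run (t, S) as \<Longrightarrow> 0 \<le> t \<Longrightarrow> t < r \<Longrightarrow> non_idling_inv (t, S)"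
  by (auto simp: non_idling_inv_def)

lemma non_idling_inv_lateI:
  "late_run (t, S) as bs \<Longrightarrow> r \<le> t \<Longrightarrow> t = finish I (max r (finish I 0 as)) bs \<Longrightarrow>
    set as = early \<or> r \<le> finish I 0 as \<Longrightarrow> as = [] \<or> finish I 0 (butlast as) < r \<Longrightarrow>
    non_idling_inv (t, S)"
  using r_pos unfolding non_idling_inv_def by fastforce

lemma non_interfering_inv_earlyI:
  "early_run (t, S) as \<Longrightarrow> 0 \<le> t \<Longrightarrow> t < r \<Longrightarrow> non_interfering_inv (t, S)"
  by (auto simp: non_interfering_inv_def)

lemma non_interfering_inv_lateI:
  "late_run (t, S) as bs \<Longrightarrow> r \<le> t \<Longrightarrow> t \<le> finish I r bs \<Longrightarrow>
    (\<And>xs. distinct xs \<Longrightarrow> set xs \<subseteq> early \<Longrightarrow> finish I 0 xs < r \<Longrightarrow> length xs \<le> length as) \<Longrightarrow>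
    non_interfering_inv (t, S)"
  using r_pos unfolding non_interfering_inv_def by fastforce

lemma early_run_start:
  assumes "early_run (t, S) as" "0 \<le> t" "t < r" "shortest_pending I t S i"
  shows "early_run (t + processing_time I i t, S(i \<mapsto> t)) (as @ [i])"
  using assms pending_early
  by (auto simp: early_run_def greedy_append finish_append shortest_pending_def)

lemma late_run_start:
  assumes "late_run (t, S) as bs" "r \<le> t" "shortest_pending I t S i"
  shows "late_run (t + processing_time I i t, S(i \<mapsto> t)) as (bs @ [i])"
  using assms pending_late
  by (auto simp: late_run_def greedy_append shortest_pending_def Diff_eq Int_assoc)

lemma early_run_late: "early_run (t, S) as \<Longrightarrow> late_run (t', S) as []"
  by (auto simp: early_run_def late_run_def)

lemma shortest_pending_job: "shortest_pending I t S i \<Longrightarrow> i \<in> jobs I"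
  by (auto simp: shortest_pending_def is_arg_min_def pending_def)

lemma finish_butlast_le:
  assumes "set as \<subseteq> jobs I"
  shows "finish I 0 (butlast as) \<le> finish I 0 as"
proof (cases as rule: rev_cases)
  case (snoc us u)
  then show ?thesis
    using assms finish_ge[of us 0] finish_ge[of "[u]" "finish I 0 us"] by (simp add: finish_append)
qed simp

lemma non_idling_inv_step:
  assumes "non_idling_step I st st'" "non_idling_inv st"
  shows "non_idling_inv st'"
  using assms(1)
proof cases
  case (start t S i)
  have t: "0 \<le> t"
    using assms(2) start by (simp add: non_idling_inv_def)
  then have t': "0 \<le> t + processing_time I i t" "t \<le> t + processing_time I i t"
    using processing_time_nonneg[of i t] shortest_pending_job start by auto
  show ?thesis
  proof (cases "t < r")
    case True
    then obtain as where as: "early_run (t, S) as"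
      using assms(2) start by (auto simp: non_idling_inv_def)
    note u = early_run_start[OF as t True start(3)]
    have f: "finish I 0 as < r" "finish I 0 (as @ [i]) = t + processing_time I i t"
      using as True u by (auto simp: early_run_def)
    show ?thesis
    proof (cases "t + processing_time I i t < r")
      case True
      then show ?thesis
        using non_idling_inv_earlyI[OF u t'(1)] start by simp
    next
      case False
      then show ?thesis
        using non_idling_inv_lateI[OF early_run_late[OF u]] f start by simp
    qed
  next
    case False
    then obtain as bs where "late_run (t, S) as bs"
        "t = finish I (max r (finish I 0 as)) bs"
        "set as = early \<or> r \<le> finish I 0 as" "as = [] \<or> finish I 0 (butlast as) < r"
      using assms(2) start by (auto simp: non_idling_inv_def)
    then show ?thesis
      using non_idling_inv_lateI[OF late_run_start[of t S as bs i]] False start t'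
      by (simp add: finish_append)
  qed
next
  case (wait t S)
  have t: "0 \<le> t"
    using assms(2) wait by (simp add: non_idling_inv_def)
  have "t < r"
    using no_future_release[of t] wait by force
  then obtain as where as: "early_run (t, S) as"
    using assms(2) wait by (auto simp: non_idling_inv_def)
  have early: "set as = early"
    using as wait pending_early[OF t \<open>t < r\<close>, of S] greedy_set
    by (fastforce simp: early_run_def)
  have r: "Min (future_releases I t) = r"
    using Min_future_releases[OF wait(4)] future_release_eq t by metis
  have "finish I 0 as < r"
    using as \<open>t < r\<close> by (simp add: early_run_def)
  then show ?thesis
    using non_idling_inv_lateI[OF early_run_late[OF as, of r]] early wait r
      finish_butlast_le[of as] early_subset
    by simp
qed

text \<open>A longer \<open>xs\<close> would end no earlier than \<open>as\<close>, so
  \<open>as\<close> would end before \<open>r\<close> and contain all early jobs.\<close>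

lemma length_le_saturated:
  assumes "greedy I early as" "set as = early \<or> r \<le> finish I 0 as"
    and "distinct xs" "set xs \<subseteq> early" "finish I 0 xs < r"
  shows "length xs \<le> length as"
proof (rule ccontr)
  assume *: "\<not> length xs \<le> length as"
  have "finish I 0 as \<le> finish I 0 xs"
    using assms * early_subset by (intro greedy_finish_le) auto
  then have "set as = early"
    using assms by auto
  then have "length xs \<le> length as"
    using assms(1,3,4) greedy_set early_subset
    by (metis List.finite_set card_mono distinct_card)
  then show False
    using * by simp
qed

text \<open>A longer \<open>xs\<close> has at least as many jobs as \<open>as @ [i]\<close> and so
  ends no earlier than that greedy list.\<close>

lemma length_le_blocked:
  assumes "greedy I early (as @ [i])" "r < finish I 0 (as @ [i])"
    and "distinct xs" "set xs \<subseteq> early" "finish I 0 xs < r"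
  shows "length xs \<le> length as"
proof (rule ccontr)
  assume "\<not> length xs \<le> length as"
  then have "finish I 0 (as @ [i]) \<le> finish I 0 xs"
    using assms early_subset by (intro greedy_finish_le) auto
  then show False
    using assms by simp
qed

lemma non_interfering_inv_step:
  assumes "non_interfering_step I st st'" "non_interfering_inv st"
  shows "non_interfering_inv st'"
  using assms(1)
proof cases
  case (start t S i)
  have t: "0 \<le> t"
    using assms(2) start by (simp add: non_interfering_inv_def)
  then have t': "0 \<le> t + processing_time I i t"
    using processing_time_nonneg[of i t] shortest_pending_job start by auto
  show ?thesis
  proof (cases "t < r")
    case True
    then obtain as where as: "early_run (t, S) as"
      using assms(2) start by (auto simp: non_interfering_inv_def)
    note u = early_run_start[OF as t True start(3)]
    have g: "greedy I early as" "greedy I early (as @ [i])" "dom S = set as"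
      and f: "finish I 0 (as @ [i]) = t + processing_time I i t"
      using as u by (auto simp: early_run_def)
    consider "t + processing_time I i t < r" | "t + processing_time I i t = r"
      | "t + processing_time I i t > r"
      by linarith
    then show ?thesis
    proof cases
      case 1
      then show ?thesis
        using non_interfering_inv_earlyI[OF u t'] start by simp
    next
      \<comment> \<open>Ending exactly at \<open>r\<close> is not crossing: \<open>i\<close> still
        belongs to the early list, which is now saturated.\<close>
      case 2
      then show ?thesis
        using non_interfering_inv_lateI[OF early_run_late[OF u], of r]
          length_le_saturated[OF g(2)] f start by simp
    next
      case 3
      \<comment> \<open>Without interference no job released at \<open>r\<close> is smaller than
        \<open>i\<close>. The crossing job is thus smallest among all unstarted jobs and can head
        \<open>bs\<close>.\<close>
      have min: "fixed_time I i \<le> fixed_time I j" if "j \<in> jobs I - set as" for j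
      proof (cases "j \<in> early")
        case True
        then show ?thesis
          using g(2) that by (auto simp: greedy_append is_arg_min_linorder)
      next
        case False
        then have "release I j = r"
          using that two_releases early_def by auto
        then show ?thesis
          using start(4) that 3 \<open>t < r\<close> by (fastforce simp: interferes_def)
      qed
      have "i \<in> jobs I - set as"
        using g(2) early_subset by (auto simp: greedy_append is_arg_min_linorder)
      then have "late_run (t + processing_time I i t, S(i \<mapsto> t)) as [i]"
        using min g start by (auto simp: late_run_def is_arg_min_linorder)
      moreover have "t + processing_time I i t \<le> finish I r [i]"
        using True rate_pos by (simp add: processing_time_def add_mono)
      ultimately show ?thesis
        using non_interfering_inv_lateI[of _ _ as "[i]"] length_le_blocked[OF g(2)] f 3 start
        by simp
    qed
  next
    case False
    then obtain as bs where *: "late_run (t, S) as bs" "t \<le> finish I r bs"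
        "\<And>xs. distinct xs \<Longrightarrow> set xs \<subseteq> early \<Longrightarrow> finish I 0 xs < r \<Longrightarrow> length xs \<le> length as"
      using assms(2) start by (auto simp: non_interfering_inv_def)
    have "r \<le> t + processing_time I i t"
      using processing_time_nonneg[of i t] shortest_pending_job start t False by force
    moreover have "t + processing_time I i t \<le> finish I r (bs @ [i])"
      using *(2) rate_pos by (simp add: finish_append processing_time_def add_mono)
    ultimately show ?thesis
      using non_interfering_inv_lateI[OF late_run_start[OF *(1) _ start(3)]] False *(3) start
      by simp
  qed
next
  case (idle t S i j)
  have t: "0 \<le> t"
    using assms(2) idle by (simp add: non_interfering_inv_def)
  have r: "release I j = r" "t < r" "r < t + processing_time I i t"
    using idle(4) future_release_eq[OF t, of j] by (auto simp: interferes_def)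
  obtain as where as: "early_run (t, S) as"
    using assms(2) idle r by (auto simp: non_interfering_inv_def)
  \<comment> \<open>Job \<open>i\<close> is not started; the hypothetical run with it only shows
    that no more than \<open>length as\<close> early jobs can end before \<open>r\<close>.\<close>
  have u: "early_run (t + processing_time I i t, S(i \<mapsto> t)) (as @ [i])"
    using early_run_start[OF as t r(2) idle(3)] .
  then have "length xs \<le> length as" if "distinct xs" "set xs \<subseteq> early" "finish I 0 xs < r" for xs
    using length_le_blocked[of as i xs] r that by (simp add: early_run_def)
  then show ?thesis
    using non_interfering_inv_lateI[OF early_run_late[OF as, of r]] idle r by simp
next
  case (wait t S)
  have t: "0 \<le> t"
    using assms(2) wait by (simp add: non_interfering_inv_def)
  have "t < r"
    using no_future_release[of t] wait by force
  then obtain as where as: "early_run (t, S) as"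
    using assms(2) wait by (auto simp: non_interfering_inv_def)
  have "set as = early" and g: "greedy I early as"
    using as wait pending_early[OF t \<open>t < r\<close>, of S] greedy_set
    by (fastforce simp: early_run_def)+
  moreover have "Min (future_releases I t) = r"
    using Min_future_releases[OF wait(4)] future_release_eq t by metis
  ultimately show ?thesis
    using non_interfering_inv_lateI[OF early_run_late[OF as, of r]]
      length_le_saturated[OF g] wait by simp
qed

lemma inv_initial: "non_idling_inv (0, Map.empty)" "non_interfering_inv (0, Map.empty)"
  using r_pos non_idling_inv_earlyI[of 0 _ "[]"] non_interfering_inv_earlyI[of 0 _ "[]"]
  by (simp_all add: early_run_def)

lemma non_idling_inv_reachable:
  "(non_idling_step I)\<^sup>*\<^sup>* (0, Map.empty) st \<Longrightarrow> non_idling_inv st"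
  by (induction rule: rtranclp_induct) (use inv_initial non_idling_inv_step in blast)+

lemma non_interfering_inv_reachable:
  "(non_interfering_step I)\<^sup>*\<^sup>* (0, Map.empty) st \<Longrightarrow> non_interfering_inv st"
  by (induction rule: rtranclp_induct) (use inv_initial non_interfering_inv_step in blast)+

subsection \<open>Comparison with an arbitrary feasible schedule\<close>

text \<open>\<open>xs\<close> are the jobs started before \<open>r\<close>. \<open>zs\<close> omits
  the last of them and therefore ends by the start of that job, before \<open>r\<close>.\<close>

lemma feasible_split:
  assumes "feasible I s" "early \<noteq> jobs I"
  obtains e xs ys zs where
    "r \<le> e" "distinct xs" "set xs \<subseteq> early" "finish I 0 xs \<le> e"
    "distinct ys" "set ys = jobs I - set xs" "finish I e ys \<le> makespan I s"
    "distinct zs" "set zs \<subseteq> early" "finish I 0 zs < r" "length zs = length xs - 1"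
proof -
  define Q where "Q = {i \<in> jobs I. s i < r}"
  have Q: "Q \<subseteq> early" "finite Q"
    using assms(1) two_releases by (force simp: Q_def early_def feasible_def, simp add: Q_def)
  then have Qj: "Q \<subseteq> jobs I"
    using early_subset by auto
  \<comment> \<open>Inserting \<open>r\<close> covers the cases that \<open>Q\<close> is empty or
    done before \<open>r\<close>.\<close>
  define e where "e = Max (insert r (completion I s ` Q))"
  have e: "r \<le> e" "\<And>i. i \<in> Q \<Longrightarrow> completion I s i \<le> e"
    using Q by (auto simp: e_def)
  have late: "e \<le> s j" if j: "j \<in> jobs I - Q" for j
  proof -
    have "completion I s i \<le> s j" if i: "i \<in> Q" for i
    proof -
      have "completion I s i \<le> s j \<or> completion I s j \<le> s i"
        using no_overlap[OF assms(1), of i j] i j Qj by blast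
      moreover have "s i < r" "r \<le> s j" "s j \<le> completion I s j"
        using i j start_le_completion[OF assms(1), of j] by (auto simp: Q_def)
      ultimately show ?thesis by simp
    qed
    then show ?thesis
      using Q j by (auto simp: e_def Q_def)
  qed
  \<comment> \<open>A job released at \<open>r\<close> cannot be in \<open>Q\<close>; its start
    shows that \<open>e\<close> does not exceed the makespan.\<close>
  obtain j where "j \<in> jobs I - Q"
    using assms(2) early_subset Q by blast
  then have "e \<le> makespan I s"
    using late[of j] start_le_completion[OF assms(1), of j] completion_le_makespan[of j s] by simp
  then obtain ys where ys: "distinct ys" "set ys = jobs I - Q" "finish I e ys \<le> makespan I s"
    using feasible_list[OF assms(1), of "jobs I - Q" e "makespan I s"] late completion_le_makespan
    by blast
  obtain xs where xs: "distinct xs" "set xs = Q" "finish I 0 xs \<le> e"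
    using feasible_list[OF assms(1) Qj, of 0 e] start_nonneg[OF assms(1)] e r_pos Qj
    by (metis in_mono less_eq_real_def order_trans)
  have "\<exists>zs. distinct zs \<and> set zs \<subseteq> early \<and> finish I 0 zs < r \<and> length zs = card Q - 1"
  proof (cases "Q = {}")
    \<comment> \<open>Truncated subtraction makes the empty list the right witness.\<close>
    case True
    then show ?thesis
      using r_pos by (intro exI[of _ "[]"]) auto
  next
    case False
    \<comment> \<open>The last job of \<open>Q\<close>; maximising start plus completion handles
      jobs of processing time 0.\<close>
    then obtain l where l: "l \<in> Q"
        "\<And>i. i \<in> Q \<Longrightarrow> - (s i + completion I s i) \<ge> - (s l + completion I s l)"
      using ex_is_arg_min_if_finite[OF Q(2), of "\<lambda>i. - (s i + completion I s i)"]
      unfolding is_arg_min_linorder by blast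
    have "completion I s i \<le> s l" if i: "i \<in> Q - {l}" for i
    proof -
      have "completion I s i \<le> s l \<or> completion I s l \<le> s i"
        using no_overlap[OF assms(1), of i l] i l Qj by blast
      moreover have "s i + completion I s i \<le> s l + completion I s l"
          "s i \<le> completion I s i" "s l \<le> completion I s l"
        using l(2)[of i] l(1) i Qj start_le_completion[OF assms(1)] by auto
      ultimately show ?thesis by linarith
    qed
    moreover have "0 \<le> s i" if "i \<in> Q" for i
      using start_nonneg[OF assms(1)] that Qj by auto
    ultimately obtain zs where zs: "distinct zs" "set zs = Q - {l}" "finish I 0 zs \<le> s l"
      using feasible_list[OF assms(1), of "Q - {l}" 0 "s l"] Qj l by blast
    then have "length zs = card Q - 1"
      using distinct_card[of zs] l Q by simp
    then show ?thesis
      using zs l Q by (intro exI[of _ zs]) (auto simp: Q_def)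
  qed
  moreover have "length xs = card Q"
    using xs distinct_card by force
  ultimately show ?thesis
    using that e(1) xs ys Q by metis
qed

text \<open>Some job is released at \<open>r\<close>, so final states fall under the second branch
  of the invariants.\<close>

lemma not_early_run:
  assumes "jobs I \<subseteq> dom S" "early \<noteq> jobs I" "early_run (t, S) as"
  shows False
  using assms early_subset greedy_set by (force simp: early_run_def)

lemma min_finish_le:
  assumes "(non_idling_step I)\<^sup>*\<^sup>* (0, Map.empty) (t, S)" "jobs I \<subseteq> dom S"
    and "(non_interfering_step I)\<^sup>*\<^sup>* (0, Map.empty) (t', S')" "jobs I \<subseteq> dom S'"
    and "feasible I s" "early \<noteq> jobs I"
  shows "min t t' \<le> 2 * makespan I s"
proof -
  obtain e xs ys zs where e: "r \<le> e"
    and xs: "distinct xs" "set xs \<subseteq> early" "finish I 0 xs \<le> e"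
    and ys: "distinct ys" "set ys = jobs I - set xs" "finish I e ys \<le> makespan I s"
    and zs: "distinct zs" "set zs \<subseteq> early" "finish I 0 zs < r" "length zs = length xs - 1"
    using feasible_split[OF assms(5,6)] by metis
  have xsj: "set xs \<subseteq> jobs I"
    using xs early_subset by auto
  \<comment> \<open>The estimate shared by both algorithms, which differ in \<open>as\<close>,
    \<open>bs\<close> and the start \<open>u\<close> of the late phase.\<close>
  have bound: "finish I u bs \<le> 2 * makespan I s"
    if "greedy I early as" "greedy I (jobs I - set as) bs" "length xs \<le> length as" "u \<le> e"
    for u as bs
  proof -
    have "card (set xs) \<le> card (set as)" "set as \<subseteq> jobs I"
      using that xs greedy_set[OF that(1)] early_subset by (auto simp: distinct_card)
    then have "finish I u bs \<le> 2 * finish I e ys"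
      using finish_le_twice[OF xs(1) refl xs(3) ys(1,2) xsj that(2)] that(4) by simp
    then show ?thesis
      using ys(3) by simp
  qed
  obtain as bs where as: "greedy I early as" "greedy I (jobs I - set as) bs"
      "t = finish I (max r (finish I 0 as)) bs"
      "set as = early \<or> r \<le> finish I 0 as" "as = [] \<or> finish I 0 (butlast as) < r"
    using non_idling_inv_reachable[OF assms(1)] not_early_run[OF assms(2,6)]
    by (auto simp: non_idling_inv_def late_run_def split: if_splits)
  obtain as' bs' where as': "greedy I early as'" "greedy I (jobs I - set as') bs'"
      "t' \<le> finish I r bs'"
      "\<And>ws. distinct ws \<Longrightarrow> set ws \<subseteq> early \<Longrightarrow> finish I 0 ws < r \<Longrightarrow> length ws \<le> length as'"
    using non_interfering_inv_reachable[OF assms(3)] not_early_run[OF assms(4,6)]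
    by (auto simp: non_interfering_inv_def late_run_def split: if_splits)
  \<comment> \<open>If \<open>xs\<close> were longer, \<open>as\<close> would leave out an early job
    and hence reach \<open>r\<close>, while \<open>zs\<close>, with at least as many jobs, ends
    before \<open>r\<close>.\<close>
  have len: "length xs \<le> length as"
  proof (rule ccontr)
    assume *: "\<not> length xs \<le> length as"
    then have "set as \<noteq> early"
      using xs greedy_set[OF as(1)] by (metis List.finite_set card_mono distinct_card)
    then have "r \<le> finish I 0 as"
      using as(4) by simp
    also have "\<dots> \<le> finish I 0 zs"
      using as(1) zs * early_subset by (intro greedy_finish_le) auto
    finally show False
      using zs(3) by simp
  qed
  show ?thesis
  proof (cases "finish I 0 as \<le> e")
    case True
    then have "t \<le> 2 * makespan I s"
      using bound[OF as(1,2) len] e as(3) by simp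
    then show ?thesis by simp
  next
    case False
    \<comment> \<open>With equal lengths the greedy \<open>as\<close> would end by \<open>e\<close>.
      So \<open>butlast as\<close>, which ends before \<open>r\<close>, still has at least as many
      jobs as \<open>xs\<close>, and \<open>as'\<close> has at least as many as
      \<open>butlast as\<close>.\<close>
    have "length xs \<noteq> length as"
      using greedy_finish_le[OF as(1) xs(1,2), of 0] early_subset xs(3) False by auto
    then have "as \<noteq> []" "length xs \<le> length (butlast as)"
      using len by auto
    moreover have "distinct (butlast as)" "set (butlast as) \<subseteq> early"
      using greedy_set[OF as(1)] by (auto simp: distinct_butlast dest: in_set_butlastD)
    ultimately have "length xs \<le> length as'"
      using as'(4)[of "butlast as"] as(5) by simp
    then have "t' \<le> 2 * makespan I s"
      using bound[OF as'(1,2) _ e] as'(3) by simp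
    then show ?thesis by simp
  qed
qed

end

section \<open>Instances with all jobs released at time 0\<close>

context valid_instance
begin

text \<open>\<open>feasible_split\<close> relies on a late job, so this case is separate: Non-Idling
  is smallest first throughout and hence optimal.\<close>

lemma non_idling_finish_le_all_early:
  assumes "(non_idling_step I)\<^sup>*\<^sup>* (0, Map.empty) (t, S)" "jobs I \<subseteq> dom S"
    and "feasible I s" "\<And>i. i \<in> jobs I \<Longrightarrow> release I i = 0"
  shows "t \<le> makespan I s"
proof -
  have t: "0 \<le> t"
    using reachable_consistent[of non_idling_step, OF non_idling_advances assms(1)]
    by (simp add: consistent_def)
  \<comment> \<open>Without late jobs the second release time is arbitrary, so it can be chosen beyond the end
    of the run.\<close>
  interpret two_release_instance I "t + 1"
    by unfold_locales (use t assms(4) in auto)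
  have early: "early = jobs I"
    using assms(4) by (auto simp: early_def)
  obtain as where as: "greedy I (jobs I) as" "dom S = set as" "t = finish I 0 as"
    using non_idling_inv_reachable[OF assms(1)]
    by (auto simp: non_idling_inv_def early_run_def early)
  obtain j where "j \<in> jobs I"
    using jobs_nonempty by blast
  then have "0 \<le> makespan I s"
    using start_nonneg start_le_completion completion_le_makespan assms(3) by (meson order_trans)
  then obtain xs where xs: "distinct xs" "set xs = jobs I" "finish I 0 xs \<le> makespan I s"
    using feasible_list[OF assms(3), of "jobs I" 0] start_nonneg[OF assms(3)]
      completion_le_makespan by blast
  have "length as = length xs"
    using greedy_set[OF as(1)] assms(2) as(2) xs by (metis distinct_card subset_antisym)
  then show ?thesis
    using greedy_finish_le[OF as(1) xs(1), of 0] xs as by simp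
qed

end

theorem theorem14:
  "approximate_on two_release_insts 2 (best_of_two non_idling non_interfering)"
  unfolding approximate_on_def
proof (intro ballI conjI allI impI)
  fix I
  assume I: "I \<in> two_release_insts"
  then obtain r where r: "r > 0" "\<And>i. i \<in> jobs I \<Longrightarrow> release I i \<in> {0, r}"
    by (auto simp: two_release_insts_def)
  interpret two_release_instance I r
    by unfold_locales (use I r in \<open>auto simp: two_release_insts_def\<close>)
  obtain s1 s2 where "non_idling I s1" "non_interfering I s2"
    using outcome_of_advancing[of non_idling_step] non_idling_advances non_idling_progress
      outcome_of_advancing[of non_interfering_step] non_interfering_advances
      non_interfering_progress
    unfolding non_idling_def non_interfering_def by metis
  then show "\<exists>s. best_of_two non_idling non_interfering I s"
    unfolding best_of_two_def by (metis insertCI min_def)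
  fix s
  assume "best_of_two non_idling non_interfering I s"
  then obtain s1 s2 where s: "non_idling I s1" "non_interfering I s2" "s \<in> {s1, s2}"
      "makespan I s = min (makespan I s1) (makespan I s2)"
    by (auto simp: best_of_two_def)
  obtain t1 S1 where 1: "(non_idling_step I)\<^sup>*\<^sup>* (0, Map.empty) (t1, S1)"
      "\<forall>i\<in>jobs I. S1 i = Some (s1 i)"
    using s(1) by (auto simp: non_idling_def outcome_def)
  obtain t2 S2 where 2: "(non_interfering_step I)\<^sup>*\<^sup>* (0, Map.empty) (t2, S2)"
      "\<forall>i\<in>jobs I. S2 i = Some (s2 i)"
    using s(2) by (auto simp: non_interfering_def outcome_def)
  have "consistent (t1, S1)"
    using non_idling_advances 1(1) by (rule reachable_consistent)
  note c1 = consistent_feasible[OF this 1(2)]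
  have "consistent (t2, S2)"
    using non_interfering_advances 2(1) by (rule reachable_consistent)
  note c2 = consistent_feasible[OF this 2(2)]
  show f: "feasible I s"
    using s(3) c1 c2 by auto
  have dom: "jobs I \<subseteq> dom S1" "jobs I \<subseteq> dom S2"
    using 1 2 by auto
  \<comment> \<open>Half the makespan is shown to be a lower bound for all feasible schedules, hence
    for the infimum.\<close>
  have "makespan I s / 2 \<le> makespan I s'" if s': "feasible I s'" for s'
  proof (cases "early = jobs I")
    case True
    then have "t1 \<le> makespan I s'"
      using non_idling_finish_le_all_early[OF 1(1) dom(1) s'] by (auto simp: early_def)
    moreover have "0 \<le> makespan I s'"
      using jobs_nonempty start_nonneg start_le_completion completion_le_makespan s'
      by (meson ex_in_conv order_trans)
    ultimately show ?thesis
      using c1 s(4) by simp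
  next
    case False
    then show ?thesis
      using min_finish_le[OF 1(1) dom(1) 2(1) dom(2) s'] c1 c2 s(4) by simp
  qed
  then have "makespan I s / 2 \<le> opt_makespan I"
    unfolding opt_makespan_def using f by (intro cINF_greatest) auto
  then show "makespan I s \<le> 2 * opt_makespan I"
    by simp
qed

end
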